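(* The functor $\mathrm{Max}$ from unital C*-algebras to unital involutive quantales is not full on isomorphisms; that is, there exist unital C*-algebras $\mathfrak{A}$ and $\mathfrak{B}$ and an isomorphism of unital involutive quantales $u:\mathrm{Max}\,\mathfrak{A}\to\mathrm{Max}\,\mathfrak{B}$ for which there is no $*$-isomorphism $v:\mathfrak{A}\to\mathfrak{B}$ with $\mathrm{Max}\,v=u$.
   Context: C*-algebras are over $\mathbb{C}$; $*$-homomorphisms are $\mathbb{C}$-linear. A unital involutive quantale is a complete lattice $Q$ with an associative multiplication $\&$ that preserves arbitrary joins in each variable, a unit $e$ for $\&$, and an involution $a\mapsto a^*$ that preserves arbitrary joins and satisfies $a^{**}=a$ and $(a\& b)^*=b^*\& a^*$. A homomorphism of unital involutive quantales is a map preserving arbitrary joins, $\&$, $e$ and ${}^*$; an isomorphism is a bijective homomorphism. For a unital C*-algebra $\mathfrak{A}$, $\mathrm{Max}\,\mathfrak{A}$ is the unital involutive quantale of all norm-closed linear subspaces of $\mathfrak{A}$, ordered by inclusion, where $a\& b$ is the closure of the linear span of $\{AB\mid A\in a,\ B\in b\}$, $a^*=\{A^*\mid A\in a\}$, and the unit is the linear span $\mathbb{C}1_{\mathfrak{A}}$. For a unital $*$-homomorphism $f:\mathfrak{A}\to\mathfrak{B}$, the homomorphism $\mathrm{Max}\,f:\mathrm{Max}\,\mathfrak{A}\to\mathrm{Max}\,\mathfrak{B}$ sends a closed subspace $a$ to the closure of $f(a)$. This makes $\mathrm{Max}$ a functor from the category of unital C*-algebras and unital $*$-homomorphisms to the category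 of unital involutive quantales and their homomorphisms. *)

theory Defs
  imports "HOL-Analysis.Abstract_Metric_Spaces" "HOL-Algebra.Module"
    "HOL-Algebra.Complete_Lattice"
begin

section \<open>Unital C*-algebras\<close>

record 'a cstar_algebra = "(complex, 'a) module" +
  star :: "'a \<Rightarrow> 'a"
  cnorm :: "'a \<Rightarrow> real"

abbreviation complex_ring :: "complex ring" where
  "complex_ring \<equiv> \<lparr>carrier = UNIV, mult = (*), one = 1, zero = 0, add = (+)\<rparr>"

text \<open>
  The library's metric spaces require non-negativity and symmetry of the distance also outside the
  carrier, where the norm is unconstrained; hence the case distinction.
\<close>

definition cdist :: "'a cstar_algebra \<Rightarrow> 'a \<Rightarrow> 'a \<Rightarrow> real" where
  "cdist A x y =
     (if x \<in> carrier A \<and> y \<in> carrier A then cnorm A (x \<ominus>\<^bsub>A\<^esub> y) else 0)"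

abbreviation norm_topology :: "'a cstar_algebra \<Rightarrow> 'a topology" where
  "norm_topology A \<equiv> Metric_space.mtopology (carrier A) (cdist A)"

text \<open>
  The library's \<open>algebra\<close> locale is commutative, so a complex algebra is assembled here from a
  (unital, associative) ring and a complex module.
\<close>

locale unital_cstar_algebra =
  Module.module complex_ring A + Ring.ring A for A :: "'a cstar_algebra" (structure) +
  assumes smult_mult_left:
      "\<lbrakk>x \<in> carrier A; y \<in> carrier A\<rbrakk> \<Longrightarrow> (c \<odot>\<^bsub>A\<^esub> x) \<otimes>\<^bsub>A\<^esub> y = c \<odot>\<^bsub>A\<^esub> (x \<otimes>\<^bsub>A\<^esub> y)"
    and smult_mult_right:
      "\<lbrakk>x \<in> carrier A; y \<in> carrier A\<rbrakk> \<Longrightarrow> x \<otimes>\<^bsub>A\<^esub> (c \<odot>\<^bsub>A\<^esub> y) = c \<odot>\<^bsub>A\<^esub> (x \<otimes>\<^bsub>A\<^esub> y)"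
    and star_closed: "x \<in> carrier A \<Longrightarrow> star A x \<in> carrier A"
    and star_star: "x \<in> carrier A \<Longrightarrow> star A (star A x) = x"
    and star_add:
      "\<lbrakk>x \<in> carrier A; y \<in> carrier A\<rbrakk> \<Longrightarrow> star A (x \<oplus>\<^bsub>A\<^esub> y) = star A x \<oplus>\<^bsub>A\<^esub> star A y"
    and star_smult: "x \<in> carrier A \<Longrightarrow> star A (c \<odot>\<^bsub>A\<^esub> x) = cnj c \<odot>\<^bsub>A\<^esub> star A x"
    and star_mult:
      "\<lbrakk>x \<in> carrier A; y \<in> carrier A\<rbrakk> \<Longrightarrow> star A (x \<otimes>\<^bsub>A\<^esub> y) = star A y \<otimes>\<^bsub>A\<^esub> star A x"
    and cnorm_nonneg: "x \<in> carrier A \<Longrightarrow> 0 \<le> cnorm A x"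
    and cnorm_eq_0: "x \<in> carrier A \<Longrightarrow> cnorm A x = 0 \<longleftrightarrow> x = \<zero>\<^bsub>A\<^esub>"
    and cnorm_triangle:
      "\<lbrakk>x \<in> carrier A; y \<in> carrier A\<rbrakk> \<Longrightarrow> cnorm A (x \<oplus>\<^bsub>A\<^esub> y) \<le> cnorm A x + cnorm A y"
    and cnorm_smult: "x \<in> carrier A \<Longrightarrow> cnorm A (c \<odot>\<^bsub>A\<^esub> x) = cmod c * cnorm A x"
    and cnorm_mult:
      "\<lbrakk>x \<in> carrier A; y \<in> carrier A\<rbrakk> \<Longrightarrow> cnorm A (x \<otimes>\<^bsub>A\<^esub> y) \<le> cnorm A x * cnorm A y"
    and cnorm_star_mult: "x \<in> carrier A \<Longrightarrow> cnorm A (star A x \<otimes>\<^bsub>A\<^esub> x) = (cnorm A x)\<^sup>2"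
    and complete: "Metric_space.mcomplete (carrier A) (cdist A)"

locale star_hom =
  dom: unital_cstar_algebra A + cod: unital_cstar_algebra B
  for A :: "'a cstar_algebra" and B :: "'b cstar_algebra" and f :: "'a \<Rightarrow> 'b" +
  assumes ring_hom: "f \<in> ring_hom A B"
    and smult: "x \<in> carrier A \<Longrightarrow> f (c \<odot>\<^bsub>A\<^esub> x) = c \<odot>\<^bsub>B\<^esub> f x"
    and star: "x \<in> carrier A \<Longrightarrow> f (star A x) = star B (f x)"

locale star_iso = star_hom +
  assumes bij: "bij_betw f (carrier A) (carrier B)"


section \<open>Unital involutive quantales\<close>

record 'a quantale = "'a gorder" +
  qmult :: "'a \<Rightarrow> 'a \<Rightarrow> 'a" (infixl "\<cdot>\<index>" 70)
  qunit :: 'a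
  qstar :: "'a \<Rightarrow> 'a"

locale unital_involutive_quantale =
  Complete_Lattice.complete_lattice Q for Q :: "'a quantale" (structure) +
  assumes qmult_closed: "\<lbrakk>a \<in> carrier Q; b \<in> carrier Q\<rbrakk> \<Longrightarrow> a \<cdot> b \<in> carrier Q"
    and qmult_assoc:
      "\<lbrakk>a \<in> carrier Q; b \<in> carrier Q; c \<in> carrier Q\<rbrakk> \<Longrightarrow> (a \<cdot> b) \<cdot> c = a \<cdot> (b \<cdot> c)"
    and qmult_Sup_left: "\<lbrakk>S \<subseteq> carrier Q; b \<in> carrier Q\<rbrakk> \<Longrightarrow> (\<Squnion>S) \<cdot> b = \<Squnion>((\<lambda>a. a \<cdot> b) ` S)"
    and qmult_Sup_right: "\<lbrakk>a \<in> carrier Q; S \<subseteq> carrier Q\<rbrakk> \<Longrightarrow> a \<cdot> (\<Squnion>S) = \<Squnion>((\<lambda>b. a \<cdot> b) ` S)"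
    and qunit_closed: "qunit Q \<in> carrier Q"
    and qunit_left: "a \<in> carrier Q \<Longrightarrow> qunit Q \<cdot> a = a"
    and qunit_right: "a \<in> carrier Q \<Longrightarrow> a \<cdot> qunit Q = a"
    and qstar_closed: "a \<in> carrier Q \<Longrightarrow> qstar Q a \<in> carrier Q"
    and qstar_Sup: "S \<subseteq> carrier Q \<Longrightarrow> qstar Q (\<Squnion>S) = \<Squnion>(qstar Q ` S)"
    and qstar_qstar: "a \<in> carrier Q \<Longrightarrow> qstar Q (qstar Q a) = a"
    and qstar_qmult:
      "\<lbrakk>a \<in> carrier Q; b \<in> carrier Q\<rbrakk> \<Longrightarrow> qstar Q (a \<cdot> b) = qstar Q b \<cdot> qstar Q a"

locale quantale_hom =
  dom: unital_involutive_quantale Q + cod: unital_involutive_quantale R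
  for Q :: "'a quantale" and R :: "'b quantale" and u :: "'a \<Rightarrow> 'b" +
  assumes closed: "u \<in> carrier Q \<rightarrow> carrier R"
    and Sup: "S \<subseteq> carrier Q \<Longrightarrow> u (\<Squnion>\<^bsub>Q\<^esub>S) = \<Squnion>\<^bsub>R\<^esub>(u ` S)"
    and qmult: "\<lbrakk>a \<in> carrier Q; b \<in> carrier Q\<rbrakk> \<Longrightarrow> u (a \<cdot>\<^bsub>Q\<^esub> b) = u a \<cdot>\<^bsub>R\<^esub> u b"
    and qunit: "u (qunit Q) = qunit R"
    and qstar: "a \<in> carrier Q \<Longrightarrow> u (qstar Q a) = qstar R (u a)"

locale quantale_iso = quantale_hom +
  assumes bij: "bij_betw u (carrier Q) (carrier R)"


section \<open>The functor Max\<close>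

definition cspan :: "'a cstar_algebra \<Rightarrow> 'a set \<Rightarrow> 'a set" where
  "cspan A S = (\<lambda>V. submodule V complex_ring A) hull S"

definition Max_quantale :: "'a cstar_algebra \<Rightarrow> 'a set quantale" where
  "Max_quantale A =
     \<lparr>carrier = {a. submodule a complex_ring A \<and> closedin (norm_topology A) a},
      eq = (=),
      le = (\<subseteq>),
      qmult = (\<lambda>a b. norm_topology A closure_of cspan A {x \<otimes>\<^bsub>A\<^esub> y | x y. x \<in> a \<and> y \<in> b}),
      qunit = cspan A {\<one>\<^bsub>A\<^esub>},
      qstar = (\<lambda>a. star A ` a)\<rparr>"

text \<open>The action of Max on a homomorphism \<open>f\<close> into \<open>B\<close>.\<close>

definition Max_map :: "'b cstar_algebra \<Rightarrow> ('a \<Rightarrow> 'b) \<Rightarrow> 'a set \<Rightarrow> 'b set" where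
  "Max_map B f a = norm_topology B closure_of (f ` a)"

end

theory Submission
  imports Defs
begin

text \<open>
  On a commutative quantale the involution is itself an automorphism.  For a commutative C*-algebra
  it maps each closed subspace to its set of adjoints.  A linear \<open>v\<close> inducing it sends
  every \<open>x\<close> to a multiple of \<open>x\<^sup>*\<close>.  On \<open>\<complex>\<^sup>2\<close> this makes
  both coordinate projections fixed, because they are self-adjoint and \<open>v\<close> is unital, so
  \<open>v\<close> is the identity; but \<open>(1, \<i>)\<close> is not a multiple of \<open>(1, -\<i>)\<close>.
\<close>

text \<open>Max A records subspaces, not scalars. On a commutative algebra the adjoint is a
  conjugate-linear ring automorphism, and conjugating coefficients does not change which sets are
  subspaces; the quantale structure cannot tell such a map from a linear one.

  Calling the involution an isomorphism requires Max A to be a quantale, and this is proved for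
  every unital C*-algebra. The obstacle is that products and joins are closures of spans, whose
  elements have no convenient description. They are therefore never computed. A closed subspace is
  determined by the closed subspaces containing it, and a product lies in c as soon as the
  elementary products do. Multiplication by a fixed subspace and the involution then have adjoints
  with respect to inclusion, from which associativity and preservation of joins follow.

  The refutation needs the action on lines only. They are closed by completeness of \<complex>, so
  no closure intervenes when Max v is applied to one.\<close>

context unital_cstar_algebra
begin

section \<open>Differences, the norm metric and the isometric adjoint\<close>

lemma minus_one_smult: "x \<in> carrier A \<Longrightarrow> (- 1) \<odot> x = \<ominus> x"
  using smult_l_distr[of "- 1" 1 x] smult_l_null[of x] smult_one[of x]
  by (intro minus_equality[symmetric]) auto

lemma smult_carrier [simp]: "x \<in> carrier A \<Longrightarrow> c \<odot> x \<in> carrier A"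
  by (rule smult_closed) simp

lemma smult_diff:
  "x \<in> carrier A \<Longrightarrow> c \<odot> x \<ominus> d \<odot> x = (c - d) \<odot> x"
  using smult_l_distr[of c "- d" x] smult_assoc1[of "- 1" d x]
  by (simp add: a_minus_def minus_one_smult)

lemma cnorm_minus: "x \<in> carrier A \<Longrightarrow> cnorm A (\<ominus> x) = cnorm A x"
  using cnorm_smult[of x "- 1"] by (simp add: minus_one_smult)

lemma cnorm_minus_commute:
  "x \<in> carrier A \<Longrightarrow> y \<in> carrier A \<Longrightarrow> cnorm A (x \<ominus> y) = cnorm A (y \<ominus> x)"
  using cnorm_minus[of "x \<ominus> y"] by (simp add: a_minus_def minus_add a_comm)

lemma diff_add_diff:
  assumes "x \<in> carrier A" "y \<in> carrier A" "z \<in> carrier A"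
  shows "(x \<ominus> y) \<oplus> (y \<ominus> z) = x \<ominus> z"
proof -
  have "(x \<ominus> y) \<oplus> (y \<ominus> z) = x \<oplus> (\<ominus> y \<oplus> (y \<oplus> \<ominus> z))"
    using assms by (simp add: a_minus_def a_assoc)
  then show ?thesis
    using assms by (simp add: r_neg1 a_minus_def)
qed

lemma minus_eq_zero_iff:
  assumes "x \<in> carrier A" "y \<in> carrier A"
  shows "x \<ominus> y = \<zero> \<longleftrightarrow> x = y"
proof
  assume "x \<ominus> y = \<zero>"
  then have "(x \<ominus> y) \<oplus> y = y"
    using assms by simp
  then show "x = y"
    using assms by (simp add: a_minus_def a_assoc l_neg)
qed (use assms in \<open>simp add: a_minus_def r_neg\<close>)

lemma cnorm_diff_triangle:
  assumes "x \<in> carrier A" "y \<in> carrier A" "z \<in> carrier A"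
  shows "cnorm A (x \<ominus> z) \<le> cnorm A (x \<ominus> y) + cnorm A (y \<ominus> z)"
  using cnorm_triangle[of "x \<ominus> y" "y \<ominus> z"] assms by (simp add: diff_add_diff)

lemma Metric_space_cdist: "Metric_space (carrier A) (cdist A)"
proof
  show "0 \<le> cdist A x y" for x y
    by (simp add: cdist_def cnorm_nonneg)
  show "cdist A x y = cdist A y x" for x y
    by (simp add: cdist_def cnorm_minus_commute)
  show "(cdist A x y = 0) = (x = y)" if "x \<in> carrier A" "y \<in> carrier A" for x y
    using that by (simp add: cdist_def cnorm_eq_0 minus_eq_zero_iff)
  show "cdist A x z \<le> cdist A x y + cdist A y z"
    if "x \<in> carrier A" "y \<in> carrier A" "z \<in> carrier A" for x y z
    using that by (simp add: cdist_def cnorm_diff_triangle)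
qed

sublocale norm: Metric_space "carrier A" "cdist A"
  by (rule Metric_space_cdist)

text \<open>The C*-identity and submultiplicativity bound the squared norm of x by
  \<open>cnorm A (star A x) * cnorm A x\<close>. Cancelling gives one inequality, and replacing x by
  its adjoint the other. Hence the adjoint is continuous.\<close>

lemma cnorm_star: "x \<in> carrier A \<Longrightarrow> cnorm A (star A x) = cnorm A x"
proof -
  have "cnorm A x \<le> cnorm A (star A x)" if x: "x \<in> carrier A" for x
  proof (cases "cnorm A x = 0")
    case False
    have "cnorm A x * cnorm A x \<le> cnorm A (star A x) * cnorm A x"
      using cnorm_star_mult[OF x] cnorm_mult[OF star_closed[OF x] x]
      by (simp add: power2_eq_square)
    then show ?thesis
      using False cnorm_nonneg[OF x] by (simp add: mult_le_cancel_right)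
  qed (use x in \<open>simp add: cnorm_nonneg star_closed\<close>)
  from this[of x] this[of "star A x"] show "x \<in> carrier A \<Longrightarrow> ?thesis"
    by (simp add: star_closed star_star)
qed

section \<open>Closures and closed subspaces in terms of the norm\<close>

lemma closure_of_cnorm:
  assumes "S \<subseteq> carrier A"
  shows "norm.mtopology closure_of S = {x \<in> carrier A. \<forall>e>0. \<exists>y\<in>S. cnorm A (x \<ominus> y) < e}"
proof -
  \<comment> \<open>Both points lie in the carrier, so \<open>cdist\<close> takes its first branch,
    the norm of the difference.\<close>
  have "y \<in> norm.mball x e \<longleftrightarrow> cnorm A (x \<ominus> y) < e" if "x \<in> carrier A" "y \<in> S" for x y e
    using that assms by (auto simp: cdist_def)
  then show ?thesis
    unfolding norm.metric_closure_of by (simp cong: conj_cong bex_cong)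
qed

lemma closedin_cnorm:
  "closedin norm.mtopology S \<longleftrightarrow> S \<subseteq> carrier A \<and>
     (\<forall>x\<in>carrier A. (\<forall>e>0. \<exists>y\<in>S. cnorm A (x \<ominus> y) < e) \<longrightarrow> x \<in> S)"
  (is "_ \<longleftrightarrow> ?rhs")
proof
  assume closed: "closedin norm.mtopology S"
  then have "S \<subseteq> carrier A"
    using closedin_subset by fastforce
  moreover from closed have "norm.mtopology closure_of S = S"
    by (simp add: closure_of_eq)
  ultimately show ?rhs
    using closure_of_cnorm[of S] by blast
next
  assume rhs: ?rhs
  then have "norm.mtopology closure_of S \<subseteq> S"
    using closure_of_cnorm[of S] by blast
  with rhs show "closedin norm.mtopology S"
    using closure_of_subset_eq[of S norm.mtopology] by simp
qed

lemma submodule_iff: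
  "submodule V complex_ring A \<longleftrightarrow> V \<subseteq> carrier A \<and> \<zero> \<in> V \<and> (\<forall>x\<in>V. \<forall>y\<in>V. x \<oplus> y \<in> V) \<and>
     (\<forall>c. \<forall>x\<in>V. c \<odot> x \<in> V)"
proof
  assume "submodule V complex_ring A"
  then interpret V: submodule V complex_ring A .
  show "V \<subseteq> carrier A \<and> \<zero> \<in> V \<and> (\<forall>x\<in>V. \<forall>y\<in>V. x \<oplus> y \<in> V) \<and> (\<forall>c. \<forall>x\<in>V. c \<odot> x \<in> V)"
    using V.subset V.one_closed V.m_closed V.smult_closed by auto
next
  assume V: "V \<subseteq> carrier A \<and> \<zero> \<in> V \<and> (\<forall>x\<in>V. \<forall>y\<in>V. x \<oplus> y \<in> V) \<and> (\<forall>c. \<forall>x\<in>V. c \<odot> x \<in> V)"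
  show "submodule V complex_ring A"
  proof (rule submoduleI)
    show "\<ominus> x \<in> V" if "x \<in> V" for x
      using V that minus_one_smult[of x] by (metis subsetD)
  qed (use V in auto)
qed

text \<open>Membership in Max A as a predicate, the form that \<open>hull\<close> takes.\<close>

definition closed_subspace :: "'a set \<Rightarrow> bool" where
  "closed_subspace V \<longleftrightarrow> submodule V complex_ring A \<and> closedin norm.mtopology V"

lemma closed_subspace_iff:
  "closed_subspace V \<longleftrightarrow> V \<subseteq> carrier A \<and> \<zero> \<in> V \<and> (\<forall>x\<in>V. \<forall>y\<in>V. x \<oplus> y \<in> V) \<and>
     (\<forall>c. \<forall>x\<in>V. c \<odot> x \<in> V) \<and>
     (\<forall>x\<in>carrier A. (\<forall>e>0. \<exists>y\<in>V. cnorm A (x \<ominus> y) < e) \<longrightarrow> x \<in> V)"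
  unfolding closed_subspace_def submodule_iff closedin_cnorm by blast

lemma closed_subspace_subset: "closed_subspace V \<Longrightarrow> V \<subseteq> carrier A"
  by (simp add: closed_subspace_iff)

text \<open>Intersecting with the carrier gives the empty family the right value, since its plain
  intersection is the whole type.\<close>

lemma closed_subspace_Inter:
  assumes "\<And>V. V \<in> F \<Longrightarrow> closed_subspace V"
  shows "closed_subspace (carrier A \<inter> \<Inter>F)"
proof -
  have limit: "x \<in> V"
    if "V \<in> F" "x \<in> carrier A" "\<forall>e>0. \<exists>y\<in>carrier A \<inter> \<Inter>F. cnorm A (x \<ominus> y) < e" for x V
  proof -
    have "\<forall>e>0. \<exists>y\<in>V. cnorm A (x \<ominus> y) < e"
      using that by (meson IntD2 InterD)
    then show ?thesis
      using assms[OF that(1)] that(2) by (simp add: closed_subspace_iff)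
  qed
  have "\<zero> \<in> V" "\<And>x y. x \<in> V \<Longrightarrow> y \<in> V \<Longrightarrow> x \<oplus> y \<in> V" "\<And>c x. x \<in> V \<Longrightarrow> c \<odot> x \<in> V"
    if "V \<in> F" for V
    using assms[OF that] unfolding closed_subspace_iff by blast+
  then show ?thesis
    unfolding closed_subspace_iff
    by (intro conjI ballI allI impI IntI InterI) (auto intro: limit)
qed

lemma closed_subspace_carrier: "closed_subspace (carrier A)"
  using closed_subspace_Inter[of "{}"] by simp

text \<open>A bounded additive map is continuous. The free \<sigma> lets one proof serve
  multiplication, which is linear, and the adjoint, which is conjugate-linear.\<close>

lemma closed_subspace_vimage:
  assumes V: "closed_subspace V"
    and g: "\<And>x. x \<in> carrier A \<Longrightarrow> g x \<in> carrier A"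
    and add: "\<And>x y. x \<in> carrier A \<Longrightarrow> y \<in> carrier A \<Longrightarrow> g (x \<oplus> y) = g x \<oplus> g y"
    and smult: "\<And>c x. x \<in> carrier A \<Longrightarrow> g (c \<odot> x) = \<sigma> c \<odot> g x"
    and bound: "\<And>x. x \<in> carrier A \<Longrightarrow> cnorm A (g x) \<le> K * cnorm A x"
  shows "closed_subspace {x \<in> carrier A. g x \<in> V}"
proof -
  have zero: "g \<zero> = \<zero>"
    using add[of \<zero> \<zero>] g[of \<zero>] by simp
  have diff: "g (x \<ominus> y) = g x \<ominus> g y" if "x \<in> carrier A" "y \<in> carrier A" for x y
  proof -
    have "g x = g (x \<ominus> y) \<oplus> g y"
      using add[of "x \<ominus> y" y] that by (simp add: a_minus_def a_assoc l_neg)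
    then show ?thesis
      using g[of y] g[of "x \<ominus> y"] that by (simp add: a_minus_def a_assoc r_neg)
  qed
  have closed: "g x \<in> V"
    if x: "x \<in> carrier A" and approx: "\<forall>e>0. \<exists>y\<in>{x \<in> carrier A. g x \<in> V}. cnorm A (x \<ominus> y) < e"
    for x
  proof -
    have "\<exists>z\<in>V. cnorm A (g x \<ominus> z) < e" if e: "e > 0" for e
    proof -
      \<comment> \<open>The sign of K is unknown, so the division is by a positive number above
        it.\<close>
      have pos: "\<bar>K\<bar> + 1 > 0"
        by simp
      then have "e / (\<bar>K\<bar> + 1) > 0"
        using e by simp
      then obtain y where y: "y \<in> carrier A" "g y \<in> V" "cnorm A (x \<ominus> y) < e / (\<bar>K\<bar> + 1)"
        using approx by blast
      have xy: "x \<ominus> y \<in> carrier A"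
        using x y by simp
      have "cnorm A (g x \<ominus> g y) \<le> K * cnorm A (x \<ominus> y)"
        using bound[OF xy] diff x y by simp
      also have "\<dots> \<le> (\<bar>K\<bar> + 1) * cnorm A (x \<ominus> y)"
        using cnorm_nonneg[OF xy] by (intro mult_right_mono) auto
      also have "\<dots> < e"
        using y(3) pos by (simp add: pos_less_divide_eq mult.commute)
      finally show ?thesis
        using y by blast
    qed
    then show ?thesis
      using V g[OF x] unfolding closed_subspace_iff by blast
  qed
  have "x \<oplus> y \<in> V" "c \<odot> x \<in> V" if "x \<in> V" "y \<in> V" for c x y
    using V that unfolding closed_subspace_iff by blast+
  moreover have "\<zero> \<in> V"
    using V unfolding closed_subspace_iff by blast
  ultimately show ?thesis
    unfolding closed_subspace_iff[of "{x \<in> carrier A. g x \<in> V}"]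
    by (intro conjI ballI allI impI subsetI) (simp_all add: zero add smult closed)
qed

lemma closed_subspace_mult_vimage:
  assumes "closed_subspace V" "y \<in> carrier A"
  shows "closed_subspace {x \<in> carrier A. x \<otimes> y \<in> V}" "closed_subspace {x \<in> carrier A. y \<otimes> x \<in> V}"
  using assms
  by (auto intro!: closed_subspace_vimage[where \<sigma> = "\<lambda>c. c" and K = "cnorm A y"]
      simp: l_distr r_distr smult_mult_left smult_mult_right cnorm_mult)
    (use cnorm_mult assms in \<open>simp add: mult.commute\<close>)

text \<open>The adjoint is its own inverse, so an image can be treated as a preimage, to which
  \<open>closed_subspace_vimage\<close> applies.\<close>

lemma star_image_eq_vimage:
  assumes "V \<subseteq> carrier A"
  shows "star A ` V = {x \<in> carrier A. star A x \<in> V}"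
  using assms star_closed star_star by (auto simp: image_iff) metis+

lemma closed_subspace_star:
  assumes "closed_subspace V"
  shows "closed_subspace (star A ` V)"
  unfolding star_image_eq_vimage[OF closed_subspace_subset[OF assms]]
  by (intro closed_subspace_vimage[where \<sigma> = cnj and K = 1])
    (simp_all add: assms star_closed star_add star_smult cnorm_star)

section \<open>Closed linear spans\<close>

definition closed_span :: "'a set \<Rightarrow> 'a set" where
  "closed_span S = closed_subspace hull S"

lemma closed_subspace_closed_span:
  assumes "S \<subseteq> carrier A"
  shows "closed_subspace (closed_span S)"
proof -
  \<comment> \<open>The carrier is itself a closed subspace above S, so intersecting with it changes
    nothing.\<close>
  have "closed_span S = carrier A \<inter> \<Inter>{V. closed_subspace V \<and> S \<subseteq> V}"
    using assms closed_subspace_carrier unfolding closed_span_def hull_def by blast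
  also have "closed_subspace \<dots>"
    by (rule closed_subspace_Inter) simp
  finally show ?thesis .
qed

text \<open>The universal property: containment is tested on generators, without limits or linear
  combinations.\<close>

lemma closed_span_subset_iff: "closed_subspace V \<Longrightarrow> closed_span S \<subseteq> V \<longleftrightarrow> S \<subseteq> V"
  unfolding closed_span_def by (rule subset_hull)

lemma closed_span_inc: "S \<subseteq> closed_span S"
  unfolding closed_span_def by (rule hull_subset)

text \<open>Addition and scaling are continuous: errors add, so each summand gets half, and scaling
  by c multiplies the error by \<open>cmod c\<close>.\<close>

lemma closed_subspace_closure_of:
  assumes V: "submodule V complex_ring A"
  shows "closed_subspace (norm.mtopology closure_of V)"
proof -
  have sub: "V \<subseteq> carrier A" and zero: "\<zero> \<in> V"
    and add: "\<And>x y. x \<in> V \<Longrightarrow> y \<in> V \<Longrightarrow> x \<oplus> y \<in> V"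
    and smult: "\<And>c x. x \<in> V \<Longrightarrow> c \<odot> x \<in> V"
    using V unfolding submodule_iff by blast+
  let ?C = "{x \<in> carrier A. \<forall>e>0. \<exists>y\<in>V. cnorm A (x \<ominus> y) < e}"
  have "x \<oplus> y \<in> ?C" if x: "x \<in> ?C" and y: "y \<in> ?C" for x y
  proof -
    have "\<exists>z\<in>V. cnorm A (x \<oplus> y \<ominus> z) < e" if "e > 0" for e
    proof -
      have half: "e / 2 > 0"
        using that by simp
      obtain x' where x': "x' \<in> V" "cnorm A (x \<ominus> x') < e / 2"
        using x half by blast
      obtain y' where y': "y' \<in> V" "cnorm A (y \<ominus> y') < e / 2"
        using y half by blast
      have carr: "x \<in> carrier A" "y \<in> carrier A" "x' \<in> carrier A" "y' \<in> carrier A"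
        using x y x' y' sub by auto
      have "x \<oplus> y \<ominus> (x' \<oplus> y') = (x \<ominus> x') \<oplus> (y \<ominus> y')"
        using carr by (simp add: a_minus_def minus_add a_ac)
      then have "cnorm A (x \<oplus> y \<ominus> (x' \<oplus> y')) < e"
        using cnorm_triangle[of "x \<ominus> x'" "y \<ominus> y'"] carr x' y' by simp
      then show ?thesis
        using x' y' add by blast
    qed
    then show ?thesis
      using x y by simp
  qed
  moreover have "c \<odot> x \<in> ?C" if x: "x \<in> ?C" for c x
  proof -
    have "\<exists>z\<in>V. cnorm A (c \<odot> x \<ominus> z) < e" if "e > 0" for e
    proof -
      \<comment> \<open>Adding 1 keeps the divisor positive when c is 0.\<close>
      have pos: "cmod c + 1 > 0"
        by (simp add: add_nonneg_pos)
      then have "e / (cmod c + 1) > 0"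
        using that by simp
      then obtain y where y: "y \<in> V" "cnorm A (x \<ominus> y) < e / (cmod c + 1)"
        using x by blast
      have carr: "x \<in> carrier A" "y \<in> carrier A"
        using x y sub by auto
      have "c \<odot> x \<ominus> c \<odot> y = c \<odot> (x \<ominus> y)"
        using carr by (simp add: a_minus_def smult_r_distr smult_r_minus)
      then have "cnorm A (c \<odot> x \<ominus> c \<odot> y) = cmod c * cnorm A (x \<ominus> y)"
        using carr by (simp add: cnorm_smult)
      also have "\<dots> \<le> (cmod c + 1) * cnorm A (x \<ominus> y)"
        using carr by (intro mult_right_mono) (auto simp: cnorm_nonneg)
      also have "\<dots> < e"
        using y(2) pos by (simp add: pos_less_divide_eq mult.commute)
      finally show ?thesis
        using y smult by blast
    qed
    then show ?thesis
      using x by simp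
  qed
  moreover have "\<zero> \<in> ?C"
    using zero cnorm_eq_0[of \<zero>] by (auto intro!: bexI[of _ \<zero>] simp: a_minus_def)
  moreover have "?C \<subseteq> carrier A"
    by simp
  ultimately have "submodule (norm.mtopology closure_of V) complex_ring A"
    unfolding closure_of_cnorm[OF sub] submodule_iff by (intro conjI ballI allI)
  then show ?thesis
    by (simp add: closed_subspace_def)
qed

text \<open>Reconciles the closure of the span, by which the quantale product is defined, with the
  hull: the former is a closed subspace above S, the latter a closed set above the span, and each is
  minimal of its kind.\<close>

lemma closure_of_cspan:
  assumes "S \<subseteq> carrier A"
  shows "norm.mtopology closure_of cspan A S = closed_span S"
proof
  have sub: "submodule (cspan A S) complex_ring A"
  proof -
    have "submodule (carrier A) complex_ring A"
      by (simp add: submodule_iff)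
    then have "cspan A S \<subseteq> carrier A"
      using assms unfolding cspan_def by (intro hull_minimal)
    moreover have "\<zero> \<in> V" "\<And>x y. x \<in> V \<Longrightarrow> y \<in> V \<Longrightarrow> x \<oplus> y \<in> V" "\<And>c x. x \<in> V \<Longrightarrow> c \<odot> x \<in> V"
      if "submodule V complex_ring A" for V
      using that unfolding submodule_iff by blast+
    ultimately show ?thesis
      unfolding submodule_iff[of "cspan A S"] by (auto simp: cspan_def hull_def)
  qed
  have inc: "cspan A S \<subseteq> norm.mtopology closure_of cspan A S"
    using sub by (intro closure_of_subset) (simp add: submodule_iff)
  show "closed_span S \<subseteq> norm.mtopology closure_of cspan A S"
    using closed_subspace_closure_of[OF sub] inc hull_subset[of S "\<lambda>V. submodule V complex_ring A"]
    by (simp add: closed_span_subset_iff cspan_def)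
  have "cspan A S \<subseteq> closed_span S"
    using closed_subspace_closed_span[OF assms] closed_span_inc[of S]
    by (simp add: cspan_def hull_minimal closed_subspace_def)
  then show "norm.mtopology closure_of cspan A S \<subseteq> closed_span S"
    using closed_subspace_closed_span[OF assms] unfolding closed_subspace_def
    by (intro closure_of_minimal) simp_all
qed

section \<open>One-dimensional subspaces\<close>

definition line :: "'a \<Rightarrow> 'a set" where
  "line x = range (\<lambda>c. c \<odot> x)"

lemma submodule_line:
  assumes "x \<in> carrier A"
  shows "submodule (line x) complex_ring A"
proof -
  have "\<zero> = 0 \<odot> x" "\<And>c d. c \<odot> x \<oplus> d \<odot> x = (c + d) \<odot> x" "\<And>c d. c \<odot> (d \<odot> x) = (c * d) \<odot> x"
    using assms smult_l_null[of x] smult_l_distr[of _ _ x] smult_assoc1[of _ _ x] by auto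
  then show ?thesis
    unfolding submodule_iff line_def using assms by auto
qed

text \<open>For nonzero x, distances between multiples of x are distances of coefficients scaled by
  \<open>cnorm A x\<close>. So the coefficients of approximants to y form a Cauchy sequence, and
  their limit in \<complex> recovers y.\<close>

lemma closed_subspace_line:
  assumes x: "x \<in> carrier A"
  shows "closed_subspace (line x)"
proof -
  have "y \<in> line x" if y: "y \<in> carrier A" and approx: "\<forall>e>0. \<exists>z\<in>line x. cnorm A (y \<ominus> z) < e" for y
  proof (cases "cnorm A x = 0")
    \<comment> \<open>With x = 0 coefficients carry no information, but the line is the zero
      subspace.\<close>
    case True
    then have "x = \<zero>"
      using cnorm_eq_0[OF x] by simp
    then have line: "line x = {\<zero>}"
      by (simp add: line_def)
    have "cnorm A y \<le> 0"
    proof (rule field_le_epsilon)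
      show "cnorm A y \<le> 0 + e" if "0 < e" for e
        using approx that y by (force simp: line a_minus_def)
    qed
    then have "y = \<zero>"
      using cnorm_eq_0[OF y] cnorm_nonneg[OF y] by simp
    then show ?thesis
      by (simp add: line)
  next
    case False
    then have pos: "cnorm A x > 0"
      using cnorm_nonneg[OF x] by simp
    have "\<forall>n. \<exists>c. cnorm A (y \<ominus> c \<odot> x) < inverse (real (Suc n))"
      using approx by (auto simp: line_def)
    then obtain c where c: "\<And>n. cnorm A (y \<ominus> c n \<odot> x) < inverse (real (Suc n))"
      by metis
    have "Cauchy c"
    proof (rule metric_CauchyI)
      fix e :: real
      assume e: "e > 0"
      \<comment> \<open>Two approximants are compared through y, hence the half; the factor
        \<open>cnorm A x\<close> is divided out at the end.\<close>
      obtain N where N: "inverse (real (Suc N)) < e * cnorm A x / 2"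
        using reals_Archimedean[of "e * cnorm A x / 2"] e pos by auto
      have "dist (c m) (c n) < e" if "m \<ge> N" "n \<ge> N" for m n
      proof -
        have "cnorm A (y \<ominus> c k \<odot> x) < e * cnorm A x / 2" if "k \<ge> N" for k
        proof -
          have "inverse (real (Suc k)) \<le> inverse (real (Suc N))"
            using that by simp
          with c[of k] N show ?thesis
            by linarith
        qed
        from this[OF that(1)] this[OF that(2)]
        have "cnorm A (c m \<odot> x \<ominus> y) + cnorm A (y \<ominus> c n \<odot> x) < e * cnorm A x"
          using x y cnorm_minus_commute[of "c m \<odot> x" y] by simp
        then have "cnorm A ((c m - c n) \<odot> x) < e * cnorm A x"
          using cnorm_diff_triangle[of "c m \<odot> x" y "c n \<odot> x"] x y by (simp add: smult_diff)
        then show ?thesis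
          using pos x by (simp add: cnorm_smult dist_norm)
      qed
      then show "\<exists>M. \<forall>m\<ge>M. \<forall>n\<ge>M. dist (c m) (c n) < e"
        by blast
    qed
    then obtain d where d: "c \<longlonglongrightarrow> d"
      using Cauchy_convergent convergent_def by blast
    \<comment> \<open>The limit is 0; it is left as a sum with \<open>d - d\<close> to match what
      the limit rules produce.\<close>
    have "(\<lambda>n. inverse (real (Suc n)) + cmod (c n - d) * cnorm A x) \<longlonglongrightarrow> 0 + cmod (d - d) * cnorm A x"
      by (intro tendsto_intros LIMSEQ_inverse_real_of_nat d)
    moreover have "cnorm A (y \<ominus> d \<odot> x) \<le> inverse (real (Suc n)) + cmod (c n - d) * cnorm A x" for n
      using cnorm_diff_triangle[of y "c n \<odot> x" "d \<odot> x"] c[of n] x y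
      by (simp add: smult_diff cnorm_smult)
    ultimately have "cnorm A (y \<ominus> d \<odot> x) \<le> 0"
      by (intro LIMSEQ_le_const) auto
    then have "y \<ominus> d \<odot> x = \<zero>"
      using cnorm_eq_0[of "y \<ominus> d \<odot> x"] cnorm_nonneg[of "y \<ominus> d \<odot> x"] x y by simp
    then have "y = d \<odot> x"
      using x y by (simp add: minus_eq_zero_iff)
    then show ?thesis
      by (simp add: line_def)
  qed
  then show ?thesis
    using submodule_line[OF x] submodule_line[OF x, unfolded submodule_iff]
    unfolding closed_subspace_def closedin_cnorm by blast
qed

lemma self_mem_line: "x \<in> carrier A \<Longrightarrow> x \<in> line x"
  unfolding line_def using smult_one[of x] by (intro range_eqI[of _ _ 1]) simp

text \<open>Identifies the quantale unit, a span taken without closure, with a line, which is known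
  to be closed.\<close>

lemma cspan_singleton:
  assumes "x \<in> carrier A"
  shows "cspan A {x} = line x"
  unfolding cspan_def
proof (rule hull_unique)
  show "line x \<subseteq> V" if "{x} \<subseteq> V" "submodule V complex_ring A" for V
    using that by (auto simp: line_def submodule_iff)
qed (use assms in \<open>simp_all add: self_mem_line submodule_line\<close>)

end


section \<open>The quantale of closed subspaces\<close>

context unital_cstar_algebra
begin

abbreviation products :: "'a set \<Rightarrow> 'a set \<Rightarrow> 'a set" where
  "products a b \<equiv> {x \<otimes> y | x y. x \<in> a \<and> y \<in> b}"

lemma Max_quantale_simps [simp]:
  "carrier (Max_quantale A) = Collect closed_subspace"
  "eq (Max_quantale A) = (=)"
  "le (Max_quantale A) = (\<subseteq>)"
  "qstar (Max_quantale A) = image (star A)"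
  "qunit (Max_quantale A) = line \<one>"
  by (auto simp: Max_quantale_def closed_subspace_def cspan_singleton)

lemma products_subset:
  "closed_subspace a \<Longrightarrow> closed_subspace b \<Longrightarrow> products a b \<subseteq> carrier A"
  using closed_subspace_subset by blast

lemma qmult_Max_quantale:
  "closed_subspace a \<Longrightarrow> closed_subspace b \<Longrightarrow> a \<cdot>\<^bsub>Max_quantale A\<^esub> b = closed_span (products a b)"
  by (simp add: Max_quantale_def closure_of_cspan products_subset)

lemma closed_subspace_qmult:
  "closed_subspace a \<Longrightarrow> closed_subspace b \<Longrightarrow> closed_subspace (a \<cdot>\<^bsub>Max_quantale A\<^esub> b)"
  by (simp add: qmult_Max_quantale closed_subspace_closed_span products_subset)

lemma qmult_subset_iff:
  assumes "closed_subspace a" "closed_subspace b" "closed_subspace c"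
  shows "a \<cdot>\<^bsub>Max_quantale A\<^esub> b \<subseteq> c \<longleftrightarrow> (\<forall>x\<in>a. \<forall>y\<in>b. x \<otimes> y \<in> c)"
  using assms by (auto simp: qmult_Max_quantale closed_span_subset_iff)

lemma Upper_Max_quantale:
  assumes "S \<subseteq> carrier (Max_quantale A)"
  shows "Upper (Max_quantale A) S = {c. closed_subspace c \<and> \<Union>S \<subseteq> c}"
  using assms by (auto simp: Upper_def)

text \<open>Joins are closed spans of unions. Meets are intersections, cut down to the carrier so
  that the empty meet is the top element.\<close>

lemma complete_lattice_Max_quantale: "Complete_Lattice.complete_lattice (Max_quantale A)"
proof -
  interpret partial_order "Max_quantale A"
    by unfold_locales auto
  show ?thesis
  proof (rule complete_latticeI)
    fix S
    assume S: "S \<subseteq> carrier (Max_quantale A)"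
    have Un: "\<Union>S \<subseteq> carrier A"
      using S closed_subspace_subset by auto
    have "least (Max_quantale A) (closed_span (\<Union>S)) (Upper (Max_quantale A) S)"
      using closed_subspace_closed_span[OF Un] closed_span_inc[of "\<Union>S"]
      unfolding least_def Upper_Max_quantale[OF S] by (auto simp: closed_span_subset_iff)
    then show "\<exists>s. least (Max_quantale A) s (Upper (Max_quantale A) S)" ..
    have "greatest (Max_quantale A) (carrier A \<inter> \<Inter>S) (Lower (Max_quantale A) S)"
      using S closed_subspace_Inter[of S] closed_subspace_subset
      by (auto simp: greatest_def Lower_def)
    then show "\<exists>i. greatest (Max_quantale A) i (Lower (Max_quantale A) S)" ..
  qed
qed

text \<open>Later arguments use joins only through this universal property.\<close>

lemma Sup_Max_quantale:
  assumes "S \<subseteq> Collect closed_subspace"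
  shows "closed_subspace (\<Squnion>\<^bsub>Max_quantale A\<^esub> S)"
    and "closed_subspace c \<Longrightarrow> \<Squnion>\<^bsub>Max_quantale A\<^esub> S \<subseteq> c \<longleftrightarrow> (\<forall>a\<in>S. a \<subseteq> c)"
proof -
  interpret Complete_Lattice.complete_lattice "Max_quantale A"
    by (rule complete_lattice_Max_quantale)
  have "least (Max_quantale A) (\<Squnion>\<^bsub>Max_quantale A\<^esub> S) (Upper (Max_quantale A) S)"
    by (rule supI) (use assms in simp_all)
  then show "closed_subspace (\<Squnion>\<^bsub>Max_quantale A\<^esub> S)"
    "closed_subspace c \<Longrightarrow> \<Squnion>\<^bsub>Max_quantale A\<^esub> S \<subseteq> c \<longleftrightarrow> (\<forall>a\<in>S. a \<subseteq> c)"
    using assms unfolding least_def by (simp_all add: Upper_Max_quantale Sup_le_iff) (meson order_trans)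
qed

text \<open>Associativity, preservation of joins and the law for adjoints of products thereby become
  equivalences of inclusions in an arbitrary c.\<close>

lemma closed_subspace_eqI:
  assumes "closed_subspace a" "closed_subspace b"
    and "\<And>c. closed_subspace c \<Longrightarrow> a \<subseteq> c \<longleftrightarrow> b \<subseteq> c"
  shows "a = b"
  using assms(3)[OF assms(1)] assms(3)[OF assms(2)] by simp

section \<open>Residuals, adjunctions and the quantale laws\<close>

lemma closed_subspace_Ball:
  assumes "\<And>y. y \<in> Y \<Longrightarrow> closed_subspace {x \<in> carrier A. P x y}"
  shows "closed_subspace {x \<in> carrier A. \<forall>y\<in>Y. P x y}"
proof -
  have "{x \<in> carrier A. \<forall>y\<in>Y. P x y} = carrier A \<inter> \<Inter>((\<lambda>y. {x \<in> carrier A. P x y}) ` Y)"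
    by auto
  then show ?thesis
    using assms closed_subspace_Inter[of "(\<lambda>y. {x \<in> carrier A. P x y}) ` Y"] by auto
qed

text \<open>The two residuals of c by b, each an intersection of preimages of c under multiplication
  by single elements of b.\<close>

lemma closed_subspace_residual:
  assumes "closed_subspace b" "closed_subspace c"
  shows "closed_subspace {x \<in> carrier A. \<forall>y\<in>b. x \<otimes> y \<in> c}"
    and "closed_subspace {x \<in> carrier A. \<forall>y\<in>b. y \<otimes> x \<in> c}"
proof -
  have "y \<in> carrier A" if "y \<in> b" for y
    using closed_subspace_subset[OF assms(1)] that ..
  then show "closed_subspace {x \<in> carrier A. \<forall>y\<in>b. x \<otimes> y \<in> c}"
    "closed_subspace {x \<in> carrier A. \<forall>y\<in>b. y \<otimes> x \<in> c}"
    by (simp_all only: closed_subspace_Ball closed_subspace_mult_vimage[OF assms(2)])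
qed

text \<open>Galois connections: in each variable, multiplication has a residual as right
  adjoint.\<close>

lemma qmult_subset_residual:
  assumes "closed_subspace a" "closed_subspace b" "closed_subspace c"
  shows "a \<cdot>\<^bsub>Max_quantale A\<^esub> b \<subseteq> c \<longleftrightarrow> a \<subseteq> {x \<in> carrier A. \<forall>y\<in>b. x \<otimes> y \<in> c}"
    and "a \<cdot>\<^bsub>Max_quantale A\<^esub> b \<subseteq> c \<longleftrightarrow> b \<subseteq> {y \<in> carrier A. \<forall>x\<in>a. x \<otimes> y \<in> c}"
  unfolding qmult_subset_iff[OF assms]
  using closed_subspace_subset[OF assms(1)] closed_subspace_subset[OF assms(2)] by auto

text \<open>An involution that preserves inclusion is its own adjoint.\<close>

lemma star_image_subset_iff:
  assumes "a \<subseteq> carrier A" "c \<subseteq> carrier A"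
  shows "star A ` a \<subseteq> c \<longleftrightarrow> a \<subseteq> star A ` c"
  using assms(1) unfolding star_image_eq_vimage[OF assms(2)] by blast

lemma star_image_star_image: "a \<subseteq> carrier A \<Longrightarrow> star A ` star A ` a = a"
  by (simp add: image_image star_star subset_iff cong: image_cong)

lemma qmult_assoc_Max_quantale:
  assumes "closed_subspace a" "closed_subspace b" "closed_subspace c"
  shows "(a \<cdot>\<^bsub>Max_quantale A\<^esub> b) \<cdot>\<^bsub>Max_quantale A\<^esub> c = a \<cdot>\<^bsub>Max_quantale A\<^esub> (b \<cdot>\<^bsub>Max_quantale A\<^esub> c)"
proof (rule closed_subspace_eqI)
  fix d
  assume d: "closed_subspace d"
  note carr = assms[THEN closed_subspace_subset, THEN subsetD]
  \<comment> \<open>Residuals of d, by c and by a; they reduce both bracketings to products of three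
    elements.\<close>
  let ?R = "{x \<in> carrier A. \<forall>z\<in>c. x \<otimes> z \<in> d}" and ?L = "{z \<in> carrier A. \<forall>x\<in>a. x \<otimes> z \<in> d}"
  have "(a \<cdot>\<^bsub>Max_quantale A\<^esub> b) \<cdot>\<^bsub>Max_quantale A\<^esub> c \<subseteq> d \<longleftrightarrow> a \<cdot>\<^bsub>Max_quantale A\<^esub> b \<subseteq> ?R"
    using assms d by (intro qmult_subset_residual closed_subspace_qmult)
  also have "\<dots> \<longleftrightarrow> (\<forall>x\<in>a. \<forall>y\<in>b. x \<otimes> y \<in> ?R)"
    using assms d by (intro qmult_subset_iff closed_subspace_residual)
  \<comment> \<open>Associativity in A enters here: both sides say that all products of three
    elements lie in d.\<close>
  also have "\<dots> \<longleftrightarrow> (\<forall>y\<in>b. \<forall>z\<in>c. y \<otimes> z \<in> ?L)"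
    using carr by (auto simp: m_assoc)
  also have "\<dots> \<longleftrightarrow> b \<cdot>\<^bsub>Max_quantale A\<^esub> c \<subseteq> ?L"
    using assms d by (intro qmult_subset_iff[symmetric] closed_subspace_residual)
  also have "\<dots> \<longleftrightarrow> a \<cdot>\<^bsub>Max_quantale A\<^esub> (b \<cdot>\<^bsub>Max_quantale A\<^esub> c) \<subseteq> d"
    using assms d by (intro qmult_subset_residual[symmetric] closed_subspace_qmult)
  finally show "(a \<cdot>\<^bsub>Max_quantale A\<^esub> b) \<cdot>\<^bsub>Max_quantale A\<^esub> c \<subseteq> d
      \<longleftrightarrow> a \<cdot>\<^bsub>Max_quantale A\<^esub> (b \<cdot>\<^bsub>Max_quantale A\<^esub> c) \<subseteq> d" .
qed (use assms in \<open>simp_all add: closed_subspace_qmult\<close>)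

text \<open>A map with a right adjoint preserves joins. Residuals give this for multiplication in
  each variable, and the involution is adjoint to itself.\<close>

theorem unital_involutive_quantale_Max_quantale: "unital_involutive_quantale (Max_quantale A)"
proof -
  interpret Complete_Lattice.complete_lattice "Max_quantale A"
    by (rule complete_lattice_Max_quantale)
  show ?thesis
  proof (unfold_locales, unfold Max_quantale_simps mem_Collect_eq)
    fix a b
    assume a: "closed_subspace a" and b: "closed_subspace b"
    show "closed_subspace (a \<cdot>\<^bsub>Max_quantale A\<^esub> b)"
      using a b by (rule closed_subspace_qmult)
    show "star A ` (a \<cdot>\<^bsub>Max_quantale A\<^esub> b) = (star A ` b) \<cdot>\<^bsub>Max_quantale A\<^esub> (star A ` a)"
    proof (rule closed_subspace_eqI)
      fix c
      assume c: "closed_subspace c"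
      note carr = a[THEN closed_subspace_subset, THEN subsetD] b[THEN closed_subspace_subset, THEN subsetD]
      have "star A ` (a \<cdot>\<^bsub>Max_quantale A\<^esub> b) \<subseteq> c \<longleftrightarrow> a \<cdot>\<^bsub>Max_quantale A\<^esub> b \<subseteq> star A ` c"
        using a b c by (intro star_image_subset_iff closed_subspace_subset closed_subspace_qmult)
      also have "\<dots> \<longleftrightarrow> (\<forall>x\<in>a. \<forall>y\<in>b. x \<otimes> y \<in> star A ` c)"
        using a b c by (intro qmult_subset_iff closed_subspace_star)
      also have "\<dots> \<longleftrightarrow> (\<forall>x\<in>star A ` b. \<forall>y\<in>star A ` a. x \<otimes> y \<in> c)"
        unfolding star_image_eq_vimage[OF closed_subspace_subset[OF c]]
        using carr by (auto simp: star_mult)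
      also have "\<dots> \<longleftrightarrow> (star A ` b) \<cdot>\<^bsub>Max_quantale A\<^esub> (star A ` a) \<subseteq> c"
        using a b c by (intro qmult_subset_iff[symmetric] closed_subspace_star)
      finally show "star A ` (a \<cdot>\<^bsub>Max_quantale A\<^esub> b) \<subseteq> c
          \<longleftrightarrow> (star A ` b) \<cdot>\<^bsub>Max_quantale A\<^esub> (star A ` a) \<subseteq> c" .
    qed (use a b in \<open>simp_all add: closed_subspace_qmult closed_subspace_star\<close>)
  next
    fix a b c
    assume "closed_subspace a" "closed_subspace b" "closed_subspace c"
    then show "(a \<cdot>\<^bsub>Max_quantale A\<^esub> b) \<cdot>\<^bsub>Max_quantale A\<^esub> c = a \<cdot>\<^bsub>Max_quantale A\<^esub> (b \<cdot>\<^bsub>Max_quantale A\<^esub> c)"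
      by (rule qmult_assoc_Max_quantale)
  next
    fix S b
    assume S: "S \<subseteq> Collect closed_subspace" and b: "closed_subspace b"
    have im: "(\<lambda>a. a \<cdot>\<^bsub>Max_quantale A\<^esub> b) ` S \<subseteq> Collect closed_subspace"
      "(\<lambda>a. b \<cdot>\<^bsub>Max_quantale A\<^esub> a) ` S \<subseteq> Collect closed_subspace"
      using S b by (auto simp: closed_subspace_qmult)
    show "(\<Squnion>\<^bsub>Max_quantale A\<^esub> S) \<cdot>\<^bsub>Max_quantale A\<^esub> b = \<Squnion>\<^bsub>Max_quantale A\<^esub> ((\<lambda>a. a \<cdot>\<^bsub>Max_quantale A\<^esub> b) ` S)"
    proof (rule closed_subspace_eqI)
      fix c
      assume c: "closed_subspace c"
      show "(\<Squnion>\<^bsub>Max_quantale A\<^esub> S) \<cdot>\<^bsub>Max_quantale A\<^esub> b \<subseteq> c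
          \<longleftrightarrow> \<Squnion>\<^bsub>Max_quantale A\<^esub> ((\<lambda>a. a \<cdot>\<^bsub>Max_quantale A\<^esub> b) ` S) \<subseteq> c"
      proof -
        \<comment> \<open>The right adjoint of multiplication by b, at c; a join lies below it
          exactly when all its members do.\<close>
        let ?R = "{x \<in> carrier A. \<forall>y\<in>b. x \<otimes> y \<in> c}"
        have "(\<Squnion>\<^bsub>Max_quantale A\<^esub> S) \<cdot>\<^bsub>Max_quantale A\<^esub> b \<subseteq> c \<longleftrightarrow> \<Squnion>\<^bsub>Max_quantale A\<^esub> S \<subseteq> ?R"
          using S b c by (intro qmult_subset_residual Sup_Max_quantale)
        also have "\<dots> \<longleftrightarrow> (\<forall>a\<in>S. a \<subseteq> ?R)"
          using S b c by (intro Sup_Max_quantale closed_subspace_residual)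
        also have "\<dots> \<longleftrightarrow> (\<forall>a\<in>S. a \<cdot>\<^bsub>Max_quantale A\<^esub> b \<subseteq> c)"
          using S b c by (intro ball_cong refl qmult_subset_residual[symmetric]) auto
        also have "\<dots> \<longleftrightarrow> \<Squnion>\<^bsub>Max_quantale A\<^esub> ((\<lambda>a. a \<cdot>\<^bsub>Max_quantale A\<^esub> b) ` S) \<subseteq> c"
          unfolding Sup_Max_quantale(2)[OF im(1) c] by simp
        finally show ?thesis .
      qed
    qed (use S b im in \<open>simp_all add: closed_subspace_qmult Sup_Max_quantale\<close>)
    show "b \<cdot>\<^bsub>Max_quantale A\<^esub> (\<Squnion>\<^bsub>Max_quantale A\<^esub> S) = \<Squnion>\<^bsub>Max_quantale A\<^esub> ((\<lambda>a. b \<cdot>\<^bsub>Max_quantale A\<^esub> a) ` S)"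
    proof (rule closed_subspace_eqI)
      fix c
      assume c: "closed_subspace c"
      show "b \<cdot>\<^bsub>Max_quantale A\<^esub> (\<Squnion>\<^bsub>Max_quantale A\<^esub> S) \<subseteq> c
          \<longleftrightarrow> \<Squnion>\<^bsub>Max_quantale A\<^esub> ((\<lambda>a. b \<cdot>\<^bsub>Max_quantale A\<^esub> a) ` S) \<subseteq> c"
      proof -
        let ?L = "{x \<in> carrier A. \<forall>y\<in>b. y \<otimes> x \<in> c}"
        have "b \<cdot>\<^bsub>Max_quantale A\<^esub> (\<Squnion>\<^bsub>Max_quantale A\<^esub> S) \<subseteq> c \<longleftrightarrow> \<Squnion>\<^bsub>Max_quantale A\<^esub> S \<subseteq> ?L"
          using S b c by (intro qmult_subset_residual Sup_Max_quantale)
        also have "\<dots> \<longleftrightarrow> (\<forall>a\<in>S. a \<subseteq> ?L)"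
          using S b c by (intro Sup_Max_quantale closed_subspace_residual)
        also have "\<dots> \<longleftrightarrow> (\<forall>a\<in>S. b \<cdot>\<^bsub>Max_quantale A\<^esub> a \<subseteq> c)"
          using S b c by (intro ball_cong refl qmult_subset_residual[symmetric]) auto
        also have "\<dots> \<longleftrightarrow> \<Squnion>\<^bsub>Max_quantale A\<^esub> ((\<lambda>a. b \<cdot>\<^bsub>Max_quantale A\<^esub> a) ` S) \<subseteq> c"
          unfolding Sup_Max_quantale(2)[OF im(2) c] by simp
        finally show ?thesis .
      qed
    qed (use S b im in \<open>simp_all add: closed_subspace_qmult Sup_Max_quantale\<close>)
  next
    show "closed_subspace (line \<one>)"
      by (simp add: closed_subspace_line)
    fix a
    assume a: "closed_subspace a"
    note carr = a[THEN closed_subspace_subset, THEN subsetD]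
    have one: "\<one> \<in> line \<one>"
      by (simp add: self_mem_line)
    have smult: "c \<odot> x \<in> a" if "x \<in> a" for c x
      using a that by (simp add: closed_subspace_iff)
    show "line \<one> \<cdot>\<^bsub>Max_quantale A\<^esub> a = a"
    proof
      show "line \<one> \<cdot>\<^bsub>Max_quantale A\<^esub> a \<subseteq> a"
        unfolding qmult_subset_iff[OF closed_subspace_line[OF one_closed] a a]
        using smult carr by (auto simp: line_def smult_mult_left)
      have "a \<subseteq> products (line \<one>) a"
        using one carr by force
      then show "a \<subseteq> line \<one> \<cdot>\<^bsub>Max_quantale A\<^esub> a"
        using a closed_span_inc by (auto simp: qmult_Max_quantale closed_subspace_line)
    qed
    show "a \<cdot>\<^bsub>Max_quantale A\<^esub> line \<one> = a"
    proof
      show "a \<cdot>\<^bsub>Max_quantale A\<^esub> line \<one> \<subseteq> a"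
        unfolding qmult_subset_iff[OF a closed_subspace_line[OF one_closed] a]
        using smult carr by (auto simp: line_def smult_mult_right)
      have "a \<subseteq> products a (line \<one>)"
        using one carr by force
      then show "a \<subseteq> a \<cdot>\<^bsub>Max_quantale A\<^esub> line \<one>"
        using a closed_span_inc by (auto simp: qmult_Max_quantale closed_subspace_line)
    qed
    show "closed_subspace (star A ` a)"
      using a by (rule closed_subspace_star)
    show "star A ` star A ` a = a"
      using a by (simp add: star_image_star_image closed_subspace_subset)
  next
    fix S
    assume S: "S \<subseteq> Collect closed_subspace"
    then have im: "image (star A) ` S \<subseteq> Collect closed_subspace"
      by (auto simp: closed_subspace_star)
    show "star A ` (\<Squnion>\<^bsub>Max_quantale A\<^esub> S) = \<Squnion>\<^bsub>Max_quantale A\<^esub> (image (star A) ` S)"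
    proof (rule closed_subspace_eqI)
      fix c
      assume c: "closed_subspace c"
      have "star A ` (\<Squnion>\<^bsub>Max_quantale A\<^esub> S) \<subseteq> c \<longleftrightarrow> \<Squnion>\<^bsub>Max_quantale A\<^esub> S \<subseteq> star A ` c"
        using c S by (intro star_image_subset_iff closed_subspace_subset Sup_Max_quantale)
      also have "\<dots> \<longleftrightarrow> (\<forall>a\<in>S. star A ` a \<subseteq> c)"
        unfolding Sup_Max_quantale(2)[OF S closed_subspace_star[OF c]]
        using c S by (intro ball_cong refl star_image_subset_iff[symmetric] closed_subspace_subset) auto
      also have "\<dots> \<longleftrightarrow> \<Squnion>\<^bsub>Max_quantale A\<^esub> (image (star A) ` S) \<subseteq> c"
        using Sup_Max_quantale(2)[OF im c] by simp
      finally show "star A ` (\<Squnion>\<^bsub>Max_quantale A\<^esub> S) \<subseteq> c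
          \<longleftrightarrow> \<Squnion>\<^bsub>Max_quantale A\<^esub> (image (star A) ` S) \<subseteq> c" .
    qed (use S im in \<open>simp_all add: Sup_Max_quantale closed_subspace_star\<close>)
  qed
qed

section \<open>The involution as an automorphism, and maps on lines\<close>

lemma qmult_commute_Max_quantale:
  assumes comm: "\<And>x y. x \<in> carrier A \<Longrightarrow> y \<in> carrier A \<Longrightarrow> x \<otimes> y = y \<otimes> x"
    and "closed_subspace a" "closed_subspace b"
  shows "a \<cdot>\<^bsub>Max_quantale A\<^esub> b = b \<cdot>\<^bsub>Max_quantale A\<^esub> a"
proof -
  have "products a b = products b a"
    using assms(2,3)[THEN closed_subspace_subset] comm by blast
  then show ?thesis
    using assms(2,3) by (simp add: qmult_Max_quantale)
qed

text \<open>Conjugation permutes the coefficients in \<complex>, so the conjugate-linear adjoint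
  still maps a line onto a line.\<close>

lemma star_image_line: "x \<in> carrier A \<Longrightarrow> star A ` line x = line (star A x)"
  by (auto simp: line_def star_smult image_iff) (metis complex_cnj_cnj)

end

text \<open>By linearity the image is itself a line, hence closed, and taking the closure adds
  nothing.\<close>

lemma (in star_hom) Max_map_line:
  assumes "x \<in> carrier A"
  shows "Max_map B f (dom.line x) = cod.line (f x)"
proof -
  have "f x \<in> carrier B"
    using ring_hom assms by (rule ring_hom_closed)
  moreover have "f ` dom.line x = cod.line (f x)"
    using assms by (simp add: dom.line_def cod.line_def image_image smult)
  ultimately show ?thesis
    using cod.closed_subspace_line[of "f x"]
    by (simp add: Max_map_def closure_of_eq cod.closed_subspace_def)
qed

text \<open>Commutativity undoes the reversal of products.\<close>

lemma (in unital_involutive_quantale) quantale_iso_qstar: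
  assumes comm: "\<And>a b. a \<in> carrier Q \<Longrightarrow> b \<in> carrier Q \<Longrightarrow> a \<cdot> b = b \<cdot> a"
  shows "quantale_iso Q Q (qstar Q)"
proof unfold_locales
  \<comment> \<open>With e the unit, applying the involution to \<open>e* e = e*\<close> gives
    \<open>e* e** = e* e = e*\<close> on the left and \<open>e** = e\<close> on the right.\<close>
  show "qstar Q (qunit Q) = qunit Q"
    by (metis qmult_closed qstar_closed qstar_qmult qstar_qstar qunit_closed qunit_left qunit_right)
  show "bij_betw (qstar Q) (carrier Q) (carrier Q)"
    by (rule bij_betw_byWitness[where f' = "qstar Q"]) (auto simp: qstar_qstar qstar_closed)
  show "qstar Q (a \<cdot> b) = qstar Q a \<cdot> qstar Q b" if "a \<in> carrier Q" "b \<in> carrier Q" for a b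
    using that by (simp add: qstar_qmult comm qstar_closed)
qed (simp_all add: qstar_closed qstar_Sup)


section \<open>The C*-algebra of pairs of complex numbers\<close>

text \<open>Vanishing from index 2 on makes two coordinates determine an element while all
  operations stay pointwise; the maximum norm is the C*-norm. In dimension one the involution of Max
  is the identity, hence induced, so two coordinates are the least that will do.\<close>

definition complex_pairs :: "(nat \<Rightarrow> complex) cstar_algebra" where
  "complex_pairs =
     \<lparr>carrier = {x. \<forall>i\<ge>2. x i = 0},
      mult = (\<lambda>x y i. x i * y i),
      one = (\<lambda>i. if i < 2 then 1 else 0),
      zero = (\<lambda>i. 0),
      add = (\<lambda>x y i. x i + y i),
      smult = (\<lambda>c x i. c * x i),
      star = (\<lambda>x i. cnj (x i)),
      cnorm = (\<lambda>x. max (cmod (x 0)) (cmod (x 1)))\<rparr>"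

lemma complex_pairs_simps [simp]:
  "x \<in> carrier complex_pairs \<longleftrightarrow> (\<forall>i\<ge>2. x i = 0)"
  "x \<otimes>\<^bsub>complex_pairs\<^esub> y = (\<lambda>i. x i * y i)"
  "\<one>\<^bsub>complex_pairs\<^esub> = (\<lambda>i. if i < 2 then 1 else 0)"
  "\<zero>\<^bsub>complex_pairs\<^esub> = (\<lambda>i. 0)"
  "x \<oplus>\<^bsub>complex_pairs\<^esub> y = (\<lambda>i. x i + y i)"
  "c \<odot>\<^bsub>complex_pairs\<^esub> x = (\<lambda>i. c * x i)"
  "star complex_pairs x = (\<lambda>i. cnj (x i))"
  "cnorm complex_pairs x = max (cmod (x 0)) (cmod (x 1))"
  by (simp_all add: complex_pairs_def)

lemma eq_complex_pairs_iff:
  assumes "x \<in> carrier complex_pairs" "y \<in> carrier complex_pairs"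
  shows "x = y \<longleftrightarrow> x 0 = y 0 \<and> x 1 = y 1"
proof
  assume eq: "x 0 = y 0 \<and> x 1 = y 1"
  show "x = y"
  proof
    show "x i = y i" for i
      using eq assms by (cases "i = 0 \<or> i = 1") auto
  qed
qed simp

lemma cring_complex_ring: "cring complex_ring"
proof (rule cringI)
  show "abelian_group complex_ring"
    by (rule abelian_groupI) (auto simp: add.assoc add.commute intro: exI[of _ "- x" for x] add.left_inverse)
qed (auto simp: comm_monoid_def monoid_def comm_monoid_axioms_def algebra_simps)

lemma ring_complex_pairs: "ring complex_pairs"
proof (rule ringI)
  show "abelian_group complex_pairs"
  proof (rule abelian_groupI)
    fix x
    assume "x \<in> carrier complex_pairs"
    then show "\<exists>y\<in>carrier complex_pairs. y \<oplus>\<^bsub>complex_pairs\<^esub> x = \<zero>\<^bsub>complex_pairs\<^esub>"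
      by (intro bexI[of _ "\<lambda>i. - x i"]) auto
  qed (auto simp: algebra_simps)
  show "monoid complex_pairs"
    by (rule monoidI) (auto simp: algebra_simps fun_eq_iff not_less)
qed (auto simp: algebra_simps)

section \<open>Metric and completeness of the pairs\<close>

lemma minus_complex_pairs:
  assumes "x \<in> carrier complex_pairs" "y \<in> carrier complex_pairs"
  shows "x \<ominus>\<^bsub>complex_pairs\<^esub> y = (\<lambda>i. x i - y i)"
proof -
  interpret ring complex_pairs
    by (rule ring_complex_pairs)
  have "\<ominus>\<^bsub>complex_pairs\<^esub> y = (\<lambda>i. - y i)"
    using assms by (intro minus_equality) auto
  then show ?thesis
    by (simp add: a_minus_def)
qed

lemma cdist_complex_pairs:
  "cdist complex_pairs x y =
     (if x \<in> carrier complex_pairs \<and> y \<in> carrier complex_pairs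
      then max (dist (x 0) (y 0)) (dist (x 1) (y 1)) else 0)"
  by (auto simp: cdist_def minus_complex_pairs dist_norm)

text \<open>Proved from the coordinates, since \<open>Metric_space_cdist\<close> assumes a
  C*-algebra and so the completeness that is to be derived from this.\<close>

lemma Metric_space_complex_pairs: "Metric_space (carrier complex_pairs) (cdist complex_pairs)"
proof
  show "(cdist complex_pairs x y = 0) = (x = y)"
    if "x \<in> carrier complex_pairs" "y \<in> carrier complex_pairs" for x y
    using that by (auto simp: cdist_complex_pairs eq_complex_pairs_iff[OF that] max_def
        simp del: complex_pairs_simps)
  show "cdist complex_pairs x z \<le> cdist complex_pairs x y + cdist complex_pairs y z"
    if "x \<in> carrier complex_pairs" "y \<in> carrier complex_pairs" "z \<in> carrier complex_pairs" for x y z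
    using that dist_triangle[of "x 0" "z 0" "y 0"] dist_triangle[of "x 1" "z 1" "y 1"]
    by (simp add: cdist_complex_pairs) linarith
qed (auto simp: cdist_complex_pairs dist_commute le_max_iff_disj)

text \<open>The metric dominates both coordinate distances and is their maximum, so completeness is
  inherited from \<complex>.\<close>

lemma mcomplete_complex_pairs:
  "Metric_space.mcomplete (carrier complex_pairs) (cdist complex_pairs)"
proof -
  interpret Metric_space "carrier complex_pairs" "cdist complex_pairs"
    by (rule Metric_space_complex_pairs)
  have "\<exists>x. limitin mtopology s x sequentially" if "MCauchy s" for s
  proof -
    have carr: "s n \<in> carrier complex_pairs" for n
      using that unfolding MCauchy_def by blast
    have cauchy: "\<exists>N. \<forall>m\<ge>N. \<forall>n\<ge>N. max (dist (s m 0) (s n 0)) (dist (s m 1) (s n 1)) < e"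
      if "e > 0" for e
      using \<open>MCauchy s\<close> that carr unfolding MCauchy_def
      by (simp add: cdist_complex_pairs del: complex_pairs_simps)
    then have "Cauchy (\<lambda>n. s n 0)" "Cauchy (\<lambda>n. s n 1)"
      by (auto intro!: metric_CauchyI) (meson max_less_iff_conj)+
    then obtain a b where lim: "(\<lambda>n. s n 0) \<longlonglongrightarrow> a" "(\<lambda>n. s n 1) \<longlonglongrightarrow> b"
      using Cauchy_convergent convergent_def by metis
    \<comment> \<open>Padding with zeros keeps the limit in the carrier.\<close>
    define x where "x = (\<lambda>i::nat. if i = 0 then a else if i = 1 then b else 0)"
    have x: "x \<in> carrier complex_pairs"
      by (simp add: x_def)
    have "\<forall>\<^sub>F n in sequentially. s n \<in> carrier complex_pairs \<and> cdist complex_pairs (s n) x < e"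
      if "e > 0" for e
      using tendstoD[OF lim(1) that] tendstoD[OF lim(2) that]
    proof eventually_elim
      case (elim n)
      then show ?case
        using carr[of n] x by (simp add: cdist_complex_pairs x_def)
    qed
    then have "limitin mtopology s x sequentially"
      using x unfolding limitin_metric by blast
    then show ?thesis
      by blast
  qed
  then show ?thesis
    unfolding mcomplete_def by blast
qed

lemma unital_cstar_algebra_complex_pairs: "unital_cstar_algebra complex_pairs"
proof -
  interpret ring complex_pairs
    by (rule ring_complex_pairs)
  have module: "module complex_ring complex_pairs"
    by (rule moduleI) (auto simp: cring_complex_ring is_abelian_group algebra_simps)
  show ?thesis
  proof (intro unital_cstar_algebra.intro unital_cstar_algebra_axioms.intro)
    fix x y
    assume x: "x \<in> carrier complex_pairs"
    show "cnorm complex_pairs x = 0 \<longleftrightarrow> x = \<zero>\<^bsub>complex_pairs\<^esub>"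
      using eq_complex_pairs_iff[OF x, of "\<zero>\<^bsub>complex_pairs\<^esub>"] by (auto simp: max_def)
    \<comment> \<open>Squaring is monotone on nonnegative reals, so it commutes with the
      maximum.\<close>
    show "cnorm complex_pairs (star complex_pairs x \<otimes>\<^bsub>complex_pairs\<^esub> x) = (cnorm complex_pairs x)\<^sup>2"
      by (simp add: norm_mult max_def power2_eq_square) (smt (verit) mult_mono norm_ge_zero)
    show "cnorm complex_pairs (x \<oplus>\<^bsub>complex_pairs\<^esub> y) \<le> cnorm complex_pairs x + cnorm complex_pairs y"
      using norm_triangle_ineq[of "x 0" "y 0"] norm_triangle_ineq[of "x 1" "y 1"] by auto
    show "cnorm complex_pairs (x \<otimes>\<^bsub>complex_pairs\<^esub> y) \<le> cnorm complex_pairs x * cnorm complex_pairs y"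
      by (auto simp: norm_mult intro!: mult_mono simp: le_max_iff_disj)
    show "cnorm complex_pairs (c \<odot>\<^bsub>complex_pairs\<^esub> x) = cmod c * cnorm complex_pairs x" for c
      by (simp add: norm_mult max_mult_distrib_left)
  qed (use module ring_complex_pairs mcomplete_complex_pairs in
      \<open>auto simp: algebra_simps le_max_iff_disj\<close>)
qed

theorem theorem3p4:
  shows "\<exists>(A :: (nat \<Rightarrow> complex) cstar_algebra) (B :: (nat \<Rightarrow> complex) cstar_algebra) u.
    unital_cstar_algebra A \<and> unital_cstar_algebra B \<and>
    quantale_iso (Max_quantale A) (Max_quantale B) u \<and>
    \<not> (\<exists>v. star_iso A B v \<and> (\<forall>a \<in> carrier (Max_quantale A). Max_map B v a = u a))"
proof -
  let ?A = complex_pairs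
  interpret unital_cstar_algebra ?A
    by (rule unital_cstar_algebra_complex_pairs)
  interpret Max: unital_involutive_quantale "Max_quantale ?A"
    by (rule unital_involutive_quantale_Max_quantale)
  have "quantale_iso (Max_quantale ?A) (Max_quantale ?A) (qstar (Max_quantale ?A))"
  proof (rule Max.quantale_iso_qstar)
    fix a b
    assume "a \<in> carrier (Max_quantale ?A)" "b \<in> carrier (Max_quantale ?A)"
    then show "a \<cdot>\<^bsub>Max_quantale ?A\<^esub> b = b \<cdot>\<^bsub>Max_quantale ?A\<^esub> a"
      by (intro qmult_commute_Max_quantale) (simp_all add: mult.commute)
  qed
  moreover have False
    if v: "star_iso ?A ?A v"
      and Max_v: "\<forall>a \<in> carrier (Max_quantale ?A). Max_map ?A v a = qstar (Max_quantale ?A) a" for v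
  proof -
    interpret v: star_iso ?A ?A v
      by (rule v)
    have v_line: "\<exists>c. v x = (\<lambda>i. c * cnj (x i))" if x: "x \<in> carrier ?A" for x
    proof -
      \<comment> \<open>On a line both maps are explicit: Max v yields the line of
        \<open>v x\<close>, the involution that of the adjoint.\<close>
      have "line (v x) = line (star ?A x)"
        using Max_v v.Max_map_line[OF x] closed_subspace_line[OF x] star_image_line[OF x] by simp
      then have "v x \<in> line (star ?A x)"
        using self_mem_line[of "v x"] ring_hom_closed[OF v.ring_hom x] by simp
      then show ?thesis
        by (auto simp: line_def)
    qed
    \<comment> \<open>The coordinates of r have a non-real ratio; conjugation would not change a
      real one.\<close>
    define p q r :: "nat \<Rightarrow> complex"
      where "p = (\<lambda>i. if i = 0 then 1 else 0)" and "q = (\<lambda>i. if i = 1 then 1 else 0)"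
        and "r = (\<lambda>i. if i = 0 then 1 else if i = 1 then \<i> else 0)"
    have carr: "p \<in> carrier ?A" "q \<in> carrier ?A" "r \<in> carrier ?A"
      by (simp_all add: p_def q_def r_def)
    obtain c d k where vp: "v p = (\<lambda>i. c * cnj (p i))" and vq: "v q = (\<lambda>i. d * cnj (q i))"
      and vr: "v r = (\<lambda>i. k * cnj (r i))"
      using v_line carr by metis
    have "\<one>\<^bsub>?A\<^esub> = p \<oplus>\<^bsub>?A\<^esub> q" and r: "r = p \<oplus>\<^bsub>?A\<^esub> \<i> \<odot>\<^bsub>?A\<^esub> q"
      by (auto simp: p_def q_def r_def)
    then have "v p \<oplus>\<^bsub>?A\<^esub> v q = \<one>\<^bsub>?A\<^esub>"
      using ring_hom_add[OF v.ring_hom carr(1,2)] ring_hom_one[OF v.ring_hom] by simp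
    \<comment> \<open>The summands live on different coordinates, so coordinate 0 of the sum is c
      and coordinate 1 is d.\<close>
    then have "c = 1" "d = 1"
      using vp vq by (auto simp: fun_eq_iff p_def q_def dest: spec[of _ 0] spec[of _ 1])
    moreover have "v r = v p \<oplus>\<^bsub>?A\<^esub> \<i> \<odot>\<^bsub>?A\<^esub> v q"
      using ring_hom_add[OF v.ring_hom carr(1), of "\<i> \<odot>\<^bsub>?A\<^esub> q"] v.smult[OF carr(2)] carr(2)
      by (simp only: r smult_carrier)
    \<comment> \<open>The first equation gives k = 1, the second k = -1.\<close>
    ultimately have "k * cnj (r 0) = 1" "k * cnj (r 1) = \<i>"
      unfolding vr vp vq by (auto simp: fun_eq_iff p_def q_def dest: spec[of _ 0] spec[of _ 1])
    then show False
      by (simp add: r_def)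
  qed
  ultimately show ?thesis
    using unital_cstar_algebra_axioms by blast
qed

end
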